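(* Let $L_s=-\partial^2+u_s$ be an algebro-geometric Schrödinger operator of level $s$ with spectral curve $\Gamma_s$, and let $K=C\langle u_s\rangle$. 1. The ring of constants of $(K[\Gamma_s],\tilde\partial)$ is $C[\Gamma_s]$. 2. The field of constants of $(K(\Gamma_s),\tilde\partial)$ is $C(\Gamma_s)$.
   Context: $(\Sigma,\partial)$ is a differential field of characteristic zero whose field of constants $C$ is algebraically closed. An operator $L\in\Sigma[\partial]\setminus C[\partial]$ of order $n$ is algebro-geometric if some $P\in\Sigma[\partial]$ of order relatively prime to $n$ satisfies $[L,P]=0$. Let $L_s=-\partial^2+u_s$ with $u_s\in\Sigma\setminus C$ be algebro-geometric. Then there is a unique monic operator $A_{2s+1}$ of minimal order $2s+1$ (minimal among operators of the centralizer not in $C[L_s]$) such that the centralizer of $L_s$ in $\Sigma[\partial]$ is $C[L_s,A_{2s+1}]$ and $A_{2s+1}^2+R_{2s+1}(L_s)=0$ with $R_{2s+1}\in C[\lambda]$ of degree $2s+1$; $A_{2s+1}$ is called the partner of $L_s$ and $s$ the level. $K=C\langle u_s\rangle$ is the differential subfield of $\Sigma$ generated by $C$ and $u_s$. Let $\lambda,\mu$ be algebraic indeterminates over $K$ with $\partial\lambda=\partial\mu=0$, so $\partial$ extends to $K[\lambda,\mu]$ coefficientwise. Put $f_s(\lambda,\mu)=\mu^2+R_{2s+1}(\lambda)$; the spectral curve $\Gamma_s\subset C^2$ is $f_s=0$. Write $(f_s)$ for the (prime) ideal generated by $f_s$ in $C[\lambda,\mu]$ or in $K[\lambda,\mu]$.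 $C[\Gamma_s]=C[\lambda,\mu]/(f_s)\hookrightarrow K[\Gamma_s]=K[\lambda,\mu]/(f_s)$, with fraction fields $C(\Gamma_s)$ and $K(\Gamma_s)$. $K[\Gamma_s]$ has the derivation $\tilde\partial(q+(f_s))=\partial(q)+(f_s)$, extended to $K(\Gamma_s)$ and also denoted $\tilde\partial$. *)

theory Defs
  imports "HOL-Algebra.QuotRing" "HOL-Computational_Algebra.Polynomial"
begin

section \<open>Differential fields\<close>

text \<open>The differential field \<open>\<Sigma>\<close> is a type of class \<^class>\<open>field_char_0\<close> with a derivation \<open>d\<close>.\<close>

definition derivation :: "('a::field_char_0 \<Rightarrow> 'a) \<Rightarrow> bool" where
  "derivation d \<longleftrightarrow> (\<forall>x y. d (x + y) = d x + d y) \<and> (\<forall>x y. d (x * y) = d x * y + x * d y)"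

definition constants :: "('a::field_char_0 \<Rightarrow> 'a) \<Rightarrow> 'a set" where
  "constants d = {c. d c = 0}"

definition poly_over :: "'a::zero set \<Rightarrow> 'a poly \<Rightarrow> bool" where
  "poly_over S p \<longleftrightarrow> (\<forall>i. coeff p i \<in> S)"

definition alg_closed_in :: "'a::field set \<Rightarrow> bool" where
  "alg_closed_in S \<longleftrightarrow> (\<forall>p. poly_over S p \<and> degree p > 0 \<longrightarrow> (\<exists>x\<in>S. poly p x = 0))"

definition diff_subfield :: "('a::field_char_0 \<Rightarrow> 'a) \<Rightarrow> 'a set \<Rightarrow> bool" where
  "diff_subfield d F \<longleftrightarrow> 0 \<in> F \<and> 1 \<in> F \<and>
     (\<forall>x\<in>F. \<forall>y\<in>F. x + y \<in> F \<and> x * y \<in> F) \<and> (\<forall>x\<in>F. - x \<in> F \<and> inverse x \<in> F \<and> d x \<in> F)"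

definition diff_field_adjoin :: "('a::field_char_0 \<Rightarrow> 'a) \<Rightarrow> 'a \<Rightarrow> 'a set" where
  "diff_field_adjoin d u = \<Inter>{F. diff_subfield d F \<and> constants d \<subseteq> F \<and> u \<in> F}"

section \<open>Ordinary differential operators\<close>

text \<open>
  An operator \<open>\<Sum>i. a\<^sub>i \<partial>\<^sup>i\<close> is encoded by the polynomial with coefficients \<open>a\<^sub>i\<close>, so that its order is
  \<^const>\<open>degree\<close> and sums are sums of polynomials.  The product of \<open>\<Sigma>[\<partial>]\<close> is \<open>dop_mult\<close>, determined by
  \<open>\<partial> a = a \<partial> + d a\<close>; it is not the commutative product \<open>*\<close> of type \<^typ>\<open>'a poly\<close>.
\<close>

definition dop_D :: "('a::field_char_0 \<Rightarrow> 'a) \<Rightarrow> 'a poly \<Rightarrow> 'a poly" where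
  "dop_D d Q = map_poly d Q + pCons 0 Q" \<comment> \<open>the product \<open>\<partial> Q\<close>\<close>

definition dop_mult :: "('a::field_char_0 \<Rightarrow> 'a) \<Rightarrow> 'a poly \<Rightarrow> 'a poly \<Rightarrow> 'a poly" where
  "dop_mult d P Q = (\<Sum>i\<le>degree P. smult (coeff P i) ((dop_D d ^^ i) Q))"

definition dop_power :: "('a::field_char_0 \<Rightarrow> 'a) \<Rightarrow> 'a poly \<Rightarrow> nat \<Rightarrow> 'a poly" where
  "dop_power d P n = (dop_mult d P ^^ n) 1"

definition dop_eval :: "('a::field_char_0 \<Rightarrow> 'a) \<Rightarrow> 'a poly \<Rightarrow> 'a poly \<Rightarrow> 'a poly" where
  "dop_eval d p L = (\<Sum>i\<le>degree p. smult (coeff p i) (dop_power d L i))"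

definition centralizer :: "('a::field_char_0 \<Rightarrow> 'a) \<Rightarrow> 'a poly \<Rightarrow> 'a poly set" where
  "centralizer d L = {P. dop_mult d L P = dop_mult d P L}"

text \<open>\<open>C[S]\<close>, the \<open>C\<close>-subalgebra of \<open>\<Sigma>[\<partial>]\<close> generated by a set of operators \<open>S\<close>.\<close>

inductive_set const_algebra :: "('a::field_char_0 \<Rightarrow> 'a) \<Rightarrow> 'a poly set \<Rightarrow> 'a poly set"
  for d :: "'a \<Rightarrow> 'a" and S :: "'a poly set" where
  const: "c \<in> constants d \<Longrightarrow> [:c:] \<in> const_algebra d S"
| gen: "P \<in> S \<Longrightarrow> P \<in> const_algebra d S"
| add: "P \<in> const_algebra d S \<Longrightarrow> Q \<in> const_algebra d S \<Longrightarrow> P + Q \<in> const_algebra d S"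
| mult: "P \<in> const_algebra d S \<Longrightarrow> Q \<in> const_algebra d S \<Longrightarrow> dop_mult d P Q \<in> const_algebra d S"

definition algebro_geometric :: "('a::field_char_0 \<Rightarrow> 'a) \<Rightarrow> 'a poly \<Rightarrow> bool" where
  "algebro_geometric d L \<longleftrightarrow> \<not> poly_over (constants d) L \<and>
     (\<exists>P. P \<noteq> 0 \<and> coprime (degree P) (degree L) \<and> P \<in> centralizer d L)"

definition schroedinger :: "'a::field_char_0 \<Rightarrow> 'a poly" where
  "schroedinger u = [:u, 0, -1:]"

text \<open>\<open>A\<close> is the partner of \<open>L\<close>, \<open>s\<close> is the level of \<open>L\<close>, and \<open>A\<^sup>2 + R(L) = 0\<close>.\<close>

definition is_partner ::
    "('a::field_char_0 \<Rightarrow> 'a) \<Rightarrow> 'a poly \<Rightarrow> nat \<Rightarrow> 'a poly \<Rightarrow> 'a poly \<Rightarrow> bool" where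
  "is_partner d L s A R \<longleftrightarrow>
     lead_coeff A = 1 \<and> degree A = 2 * s + 1 \<and>
     A \<in> centralizer d L - const_algebra d {L} \<and>
     (\<forall>P \<in> centralizer d L - const_algebra d {L}. degree A \<le> degree P) \<and>
     centralizer d L = const_algebra d {L, A} \<and>
     poly_over (constants d) R \<and> degree R = 2 * s + 1 \<and>
     dop_mult d A A + dop_eval d R L = 0"

section \<open>Coordinate rings of the spectral curve\<close>

text \<open>
  In \<^typ>\<open>'a poly poly\<close> the inner variable is \<open>\<lambda>\<close> and the outer variable is \<open>\<mu>\<close>.
  For a subfield \<open>S\<close>, \<open>bipoly_ring S\<close> is \<open>S[\<lambda>, \<mu>]\<close>.
\<close>

definition bipoly_ring :: "'a::field set \<Rightarrow> 'a poly poly ring" where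
  "bipoly_ring S = \<lparr>carrier = {q. \<forall>i. poly_over S (coeff q i)},
     monoid.mult = (*), one = 1, zero = 0, add = (+)\<rparr>"

definition spectral_poly :: "'a::field poly \<Rightarrow> 'a poly poly" where
  "spectral_poly R = [:R, 0, 1:]" \<comment> \<open>\<open>\<mu>\<^sup>2 + R(\<lambda>)\<close>\<close>

definition bipoly_deriv :: "('a::field_char_0 \<Rightarrow> 'a) \<Rightarrow> 'a poly poly \<Rightarrow> 'a poly poly" where
  "bipoly_deriv d = map_poly (map_poly d)"

definition curve_ideal :: "'a::field set \<Rightarrow> 'a poly poly \<Rightarrow> 'a poly poly set" where
  "curve_ideal S f = PIdl\<^bsub>bipoly_ring S\<^esub> f"

definition curve_coset :: "'a::field set \<Rightarrow> 'a poly poly \<Rightarrow> 'a poly poly \<Rightarrow> 'a poly poly set" where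
  "curve_coset S f q = curve_ideal S f +>\<^bsub>bipoly_ring S\<^esub> q"

definition coord_ring :: "'a::field set \<Rightarrow> 'a poly poly \<Rightarrow> 'a poly poly set ring" where
  "coord_ring S f = bipoly_ring S Quot curve_ideal S f"

text \<open>
  Maps on cosets, and below on fractions, are defined as the union of the values obtained from all
  representatives; when the map is well defined these values coincide.
\<close>

definition coord_deriv ::
    "('a::field_char_0 \<Rightarrow> 'a) \<Rightarrow> 'a set \<Rightarrow> 'a poly poly \<Rightarrow> 'a poly poly set \<Rightarrow> 'a poly poly set" where
  "coord_deriv d S f X = (\<Union>q\<in>X. curve_coset S f (bipoly_deriv d q))"

text \<open>The natural map from \<open>C[\<lambda>, \<mu>]/(f)\<close> to \<open>K[\<lambda>, \<mu>]/(f)\<close>, where \<open>K\<close> contains \<open>C\<close>.\<close>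

definition coord_embed :: "'a::field set \<Rightarrow> 'a poly poly \<Rightarrow> 'a poly poly set \<Rightarrow> 'a poly poly set" where
  "coord_embed K f X = (\<Union>q\<in>X. curve_coset K f q)"

section \<open>Fraction field of an integral domain\<close>

definition ring_frac :: "('r, 'm) ring_scheme \<Rightarrow> 'r \<Rightarrow> 'r \<Rightarrow> ('r \<times> 'r) set" where
  "ring_frac R a b = {(x, y). x \<in> carrier R \<and> y \<in> carrier R - {\<zero>\<^bsub>R\<^esub>} \<and> a \<otimes>\<^bsub>R\<^esub> y = x \<otimes>\<^bsub>R\<^esub> b}"

definition frac_field :: "('r, 'm) ring_scheme \<Rightarrow> ('r \<times> 'r) set ring" where
  "frac_field R = \<lparr>carrier = {ring_frac R a b |a b. a \<in> carrier R \<and> b \<in> carrier R - {\<zero>\<^bsub>R\<^esub>}},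
     monoid.mult = (\<lambda>X Y. \<Union>(a, b)\<in>X. \<Union>(x, y)\<in>Y. ring_frac R (a \<otimes>\<^bsub>R\<^esub> x) (b \<otimes>\<^bsub>R\<^esub> y)),
     one = ring_frac R \<one>\<^bsub>R\<^esub> \<one>\<^bsub>R\<^esub>,
     zero = ring_frac R \<zero>\<^bsub>R\<^esub> \<one>\<^bsub>R\<^esub>,
     add = (\<lambda>X Y. \<Union>(a, b)\<in>X. \<Union>(x, y)\<in>Y.
              ring_frac R (a \<otimes>\<^bsub>R\<^esub> y \<oplus>\<^bsub>R\<^esub> x \<otimes>\<^bsub>R\<^esub> b) (b \<otimes>\<^bsub>R\<^esub> y))\<rparr>"

text \<open>Extension of a derivation \<open>D\<close> of \<open>R\<close> by the quotient rule.\<close>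

definition frac_deriv ::
    "('r, 'm) ring_scheme \<Rightarrow> ('r \<Rightarrow> 'r) \<Rightarrow> ('r \<times> 'r) set \<Rightarrow> ('r \<times> 'r) set" where
  "frac_deriv R D X =
     (\<Union>(a, b)\<in>X. ring_frac R (D a \<otimes>\<^bsub>R\<^esub> b \<ominus>\<^bsub>R\<^esub> a \<otimes>\<^bsub>R\<^esub> D b) (b \<otimes>\<^bsub>R\<^esub> b))"

text \<open>The map of fraction fields induced by an injective homomorphism \<open>h\<close> into \<open>T\<close>.\<close>

definition frac_map ::
    "('t, 'm) ring_scheme \<Rightarrow> ('r \<Rightarrow> 't) \<Rightarrow> ('r \<times> 'r) set \<Rightarrow> ('t \<times> 't) set" where
  "frac_map T h X = (\<Union>(a, b)\<in>X. ring_frac T (h a) (h b))"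

definition constants_ring :: "('r, 'm) ring_scheme \<Rightarrow> ('r \<Rightarrow> 'r) \<Rightarrow> ('r, 'm) ring_scheme" where
  "constants_ring R D = R\<lparr>carrier := {x \<in> carrier R. D x = \<zero>\<^bsub>R\<^esub>}\<rparr>"

end

theory Submission
  imports Defs
begin

text \<open>
  Write \<open>f = \<mu>\<^sup>2 + R(\<lambda>)\<close> with \<open>R\<close> of odd degree and constant coefficients.  Since \<open>f\<close> is monic of
  degree 2 in \<open>\<mu>\<close>, every class of \<open>K[\<lambda>, \<mu>]/(f)\<close> has exactly one representative \<open>a + b \<mu>\<close> with
  \<open>a, b \<in> K[\<lambda>]\<close>, and since \<open>f\<close> has derivative 0 the derivation acts by
  \<open>a + b \<mu> \<mapsto> a' + b' \<mu>\<close>.  Hence a constant class has \<open>a' = b' = 0\<close>, that is,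
  \<open>a, b \<in> C[\<lambda>]\<close>; this is the first claim.

  The norm \<open>a\<^sup>2 + R b\<^sup>2\<close> of \<open>a + b \<mu>\<close> is multiplicative modulo \<open>f\<close>, and it vanishes only for
  \<open>a = b = 0\<close>, because \<open>a\<^sup>2\<close> has even degree while \<open>R b\<^sup>2\<close> has odd degree (\<open>spectral_norm_eq_0\<close>).
  So \<open>f\<close> is prime (\<open>spectral_dvd_mult\<close>) and the coordinate rings are domains.

  For the second claim let \<open>p/q\<close> be a constant fraction.  Multiplying \<open>q\<close> by its conjugate shows that
  \<open>p/q = x/y\<close> for some nonzero polynomial \<open>y\<close> in \<open>\<lambda>\<close> alone.  Take \<open>y\<close> monic of least degree.
  Differentiating \<open>p y = x q\<close> and using that \<open>p/q\<close> is constant gives \<open>p y' = x' q\<close>, where \<open>y'\<close> has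
  smaller degree than \<open>y\<close> because \<open>y\<close> is monic.  By minimality \<open>y' = 0\<close>, hence \<open>x' = 0\<close>: both \<open>x\<close>
  and \<open>y\<close> have coefficients in \<open>C\<close> (\<open>constant_fraction\<close>).

  The passage from this divisibility statement to fraction fields is formal
  (\<open>frac_map_iso_constants\<close>): if every pair \<open>a, b\<close> with \<open>D a \<cdot> b = a \<cdot> D b\<close> is proportional to a pair
  of elements of the constant subring, then the constants of the fraction field are the fractions of
  the constant subring.
\<close>

section \<open>Constants of a fraction field\<close>

text \<open>
  The operations on fractions are unions over all representatives; a union of equal sets over a
  nonempty index set is that set, which turns independence of the representatives into an evaluation
  rule.
\<close>

lemma UN_pairs_constant:
  assumes "z \<in> X" and F: "\<And>a b. (a, b) \<in> X \<Longrightarrow> F a b = V"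
  shows "(\<Union>(a, b)\<in>X. F a b) = V"
proof -
  have "case_prod F p = V" if "p \<in> X" for p
    using F[of "fst p" "snd p"] that by (simp add: case_prod_beta)
  hence "(\<Union>(a, b)\<in>X. F a b) = (\<Union>p\<in>X. V)" by (intro SUP_cong refl)
  thus ?thesis using assms(1) by blast
qed

lemma (in cring) minus_eq_zero_iff:
  assumes "a \<in> carrier R" "b \<in> carrier R"
  shows "a \<ominus> b = \<zero> \<longleftrightarrow> a = b"
proof
  have "a = (a \<ominus> b) \<oplus> b" using assms by algebra
  moreover assume "a \<ominus> b = \<zero>"
  ultimately show "a = b" using assms by simp
qed (use assms in \<open>simp add: minus_eq r_neg\<close>)

lemma (in domain) ring_frac_self:
  "a \<in> carrier R \<Longrightarrow> b \<in> carrier R - {\<zero>} \<Longrightarrow> (a, b) \<in> ring_frac R a b"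
  by (auto simp: ring_frac_def)

text \<open>
  Cross-multiplication is transitive because the middle denominator can be cancelled in a domain.
\<close>

lemma (in domain) ring_frac_eq_iff:
  assumes "a \<in> carrier R" "b \<in> carrier R - {\<zero>}" "x \<in> carrier R" "y \<in> carrier R - {\<zero>}"
  shows "ring_frac R a b = ring_frac R x y \<longleftrightarrow> a \<otimes> y = x \<otimes> b"
proof
  assume "ring_frac R a b = ring_frac R x y"
  with ring_frac_self[OF assms(3,4)] have "(x, y) \<in> ring_frac R a b" by simp
  thus "a \<otimes> y = x \<otimes> b" by (simp add: ring_frac_def)
next
  have trans: "a' \<otimes> z = w \<otimes> b'"
    if e: "a' \<otimes> y' = x' \<otimes> b'" "x' \<otimes> z = w \<otimes> y'"
      and c: "a' \<in> carrier R" "b' \<in> carrier R - {\<zero>}" "x' \<in> carrier R" "y' \<in> carrier R - {\<zero>}"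
        "w \<in> carrier R" "z \<in> carrier R - {\<zero>}" for a' b' x' y' w z
  proof -
    have "y' \<otimes> (a' \<otimes> z) = (a' \<otimes> y') \<otimes> z" using c by (simp add: m_ac)
    also have "\<dots> = b' \<otimes> (x' \<otimes> z)" using c e(1) by (simp add: m_ac)
    also have "\<dots> = y' \<otimes> (w \<otimes> b')" using c e(2) by (simp add: m_ac)
    finally show ?thesis using c by (simp add: m_lcancel)
  qed
  assume eq: "a \<otimes> y = x \<otimes> b"
  show "ring_frac R a b = ring_frac R x y"
    using trans[OF eq[symmetric], of _ _] trans[OF eq] assms unfolding ring_frac_def by blast
qed

lemma (in domain) frac_field_carrierE:
  assumes "X \<in> carrier (frac_field R)"
  obtains a b where "a \<in> carrier R" "b \<in> carrier R - {\<zero>}" "X = ring_frac R a b"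
  using assms by (auto simp: frac_field_def)

lemma (in domain) ring_frac_closed:
  "a \<in> carrier R \<Longrightarrow> b \<in> carrier R - {\<zero>} \<Longrightarrow> ring_frac R a b \<in> carrier (frac_field R)"
  by (auto simp: frac_field_def)

lemma (in domain) nonzero_mult_closed:
  "b \<in> carrier R - {\<zero>} \<Longrightarrow> y \<in> carrier R - {\<zero>} \<Longrightarrow> b \<otimes> y \<in> carrier R - {\<zero>}"
  using integral_iff by auto

lemma (in domain) frac_field_mult:
  assumes c: "a \<in> carrier R" "b \<in> carrier R - {\<zero>}" "x \<in> carrier R" "y \<in> carrier R - {\<zero>}"
  shows "ring_frac R a b \<otimes>\<^bsub>frac_field R\<^esub> ring_frac R x y = ring_frac R (a \<otimes> x) (b \<otimes> y)"
proof -
  have eq: "ring_frac R (a' \<otimes> x') (b' \<otimes> y') = ring_frac R (a \<otimes> x) (b \<otimes> y)"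
    if m: "(a', b') \<in> ring_frac R a b" "(x', y') \<in> ring_frac R x y" for a' b' x' y'
  proof -
    from m have c': "a' \<in> carrier R" "b' \<in> carrier R - {\<zero>}" "x' \<in> carrier R" "y' \<in> carrier R - {\<zero>}"
      and e: "a \<otimes> b' = a' \<otimes> b" "x \<otimes> y' = x' \<otimes> y"
      by (auto simp: ring_frac_def)
    have "(a' \<otimes> x') \<otimes> (b \<otimes> y) = (a' \<otimes> b) \<otimes> (x' \<otimes> y)" using c c' by (simp add: m_ac)
    also have "\<dots> = (a \<otimes> x) \<otimes> (b' \<otimes> y')" unfolding e[symmetric] using c c' by (simp add: m_ac)
    finally show ?thesis
      using c c' nonzero_mult_closed by (subst ring_frac_eq_iff) simp_all
  qed
  have "(\<Union>(x', y')\<in>ring_frac R x y. ring_frac R (a' \<otimes> x') (b' \<otimes> y'))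
      = ring_frac R (a \<otimes> x) (b \<otimes> y)" if "(a', b') \<in> ring_frac R a b" for a' b'
    by (rule UN_pairs_constant[OF ring_frac_self[OF c(3,4)]], rule eq[OF that])
  hence "(\<Union>(a', b')\<in>ring_frac R a b. \<Union>(x', y')\<in>ring_frac R x y.
      ring_frac R (a' \<otimes> x') (b' \<otimes> y')) = ring_frac R (a \<otimes> x) (b \<otimes> y)"
    by (rule UN_pairs_constant[OF ring_frac_self[OF c(1,2)]])
  thus ?thesis by (simp only: frac_field_def monoid.select_convs ring.select_convs)
qed

lemma (in domain) frac_field_add:
  assumes c: "a \<in> carrier R" "b \<in> carrier R - {\<zero>}" "x \<in> carrier R" "y \<in> carrier R - {\<zero>}"
  shows "ring_frac R a b \<oplus>\<^bsub>frac_field R\<^esub> ring_frac R x y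
    = ring_frac R (a \<otimes> y \<oplus> x \<otimes> b) (b \<otimes> y)"
proof -
  have eq: "ring_frac R (a' \<otimes> y' \<oplus> x' \<otimes> b') (b' \<otimes> y') = ring_frac R (a \<otimes> y \<oplus> x \<otimes> b) (b \<otimes> y)"
    if m: "(a', b') \<in> ring_frac R a b" "(x', y') \<in> ring_frac R x y" for a' b' x' y'
  proof -
    from m have c': "a' \<in> carrier R" "b' \<in> carrier R - {\<zero>}" "x' \<in> carrier R" "y' \<in> carrier R - {\<zero>}"
      and e: "a \<otimes> b' = a' \<otimes> b" "x \<otimes> y' = x' \<otimes> y"
      by (auto simp: ring_frac_def)
    have "(a' \<otimes> y' \<oplus> x' \<otimes> b') \<otimes> (b \<otimes> y) = (a' \<otimes> b) \<otimes> (y \<otimes> y') \<oplus> (x' \<otimes> y) \<otimes> (b \<otimes> b')"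
      using c c' by (simp add: m_ac l_distr r_distr)
    also have "\<dots> = (a \<otimes> y \<oplus> x \<otimes> b) \<otimes> (b' \<otimes> y')"
      unfolding e[symmetric] using c c' by (simp add: m_ac l_distr r_distr)
    finally show ?thesis
      using c c' nonzero_mult_closed by (subst ring_frac_eq_iff) simp_all
  qed
  have "(\<Union>(x', y')\<in>ring_frac R x y. ring_frac R (a' \<otimes> y' \<oplus> x' \<otimes> b') (b' \<otimes> y'))
      = ring_frac R (a \<otimes> y \<oplus> x \<otimes> b) (b \<otimes> y)" if "(a', b') \<in> ring_frac R a b" for a' b'
    by (rule UN_pairs_constant[OF ring_frac_self[OF c(3,4)]], rule eq[OF that])
  hence "(\<Union>(a', b')\<in>ring_frac R a b. \<Union>(x', y')\<in>ring_frac R x y.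
      ring_frac R (a' \<otimes> y' \<oplus> x' \<otimes> b') (b' \<otimes> y')) = ring_frac R (a \<otimes> y \<oplus> x \<otimes> b) (b \<otimes> y)"
    by (rule UN_pairs_constant[OF ring_frac_self[OF c(1,2)]])
  thus ?thesis by (simp only: frac_field_def monoid.select_convs ring.select_convs)
qed

text \<open>
  The quotient rule respects cross-multiplication: differentiate \<open>a y = x b\<close> and multiply by \<open>y b\<close>.
\<close>

lemma (in domain) frac_deriv_ring_frac:
  assumes D: "\<And>a. a \<in> carrier R \<Longrightarrow> D a \<in> carrier R"
    and Leibniz: "\<And>a b. a \<in> carrier R \<Longrightarrow> b \<in> carrier R \<Longrightarrow> D (a \<otimes> b) = D a \<otimes> b \<oplus> a \<otimes> D b"
    and c: "a \<in> carrier R" "b \<in> carrier R - {\<zero>}"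
  shows "frac_deriv R D (ring_frac R a b) = ring_frac R (D a \<otimes> b \<ominus> a \<otimes> D b) (b \<otimes> b)"
proof -
  have "ring_frac R (D x \<otimes> y \<ominus> x \<otimes> D y) (y \<otimes> y) = ring_frac R (D a \<otimes> b \<ominus> a \<otimes> D b) (b \<otimes> b)"
    if "(x, y) \<in> ring_frac R a b" for x y
  proof -
    from that have c': "x \<in> carrier R" "y \<in> carrier R - {\<zero>}" and e: "a \<otimes> y = x \<otimes> b"
      by (auto simp: ring_frac_def)
    note C = c c' D[OF c(1)] D[OF c'(1)] D[of b] D[of y]
    have "D a \<otimes> y \<oplus> a \<otimes> D y = D x \<otimes> b \<oplus> x \<otimes> D b"
      using Leibniz[of a y] Leibniz[of x b] C e by simp
    hence e': "D x \<otimes> b = D a \<otimes> y \<oplus> a \<otimes> D y \<ominus> x \<otimes> D b"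
      using C by (simp add: minus_eq a_assoc r_neg)
    have "(D x \<otimes> y \<ominus> x \<otimes> D y) \<otimes> (b \<otimes> b) = (D x \<otimes> b) \<otimes> (y \<otimes> b) \<ominus> (x \<otimes> b) \<otimes> (D y \<otimes> b)"
      using C by (simp, algebra)
    also have "\<dots> = (D a \<otimes> y \<oplus> a \<otimes> D y \<ominus> x \<otimes> D b) \<otimes> (y \<otimes> b) \<ominus> (a \<otimes> y) \<otimes> (D y \<otimes> b)"
      unfolding e' e ..
    also have "\<dots> = (D a \<otimes> b) \<otimes> (y \<otimes> y) \<ominus> (x \<otimes> b) \<otimes> (y \<otimes> D b)"
      using C by (simp, algebra)
    also have "\<dots> = (D a \<otimes> b \<ominus> a \<otimes> D b) \<otimes> (y \<otimes> y)"
      unfolding e[symmetric] using C by (simp, algebra)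
    finally show ?thesis
      using C nonzero_mult_closed by (subst ring_frac_eq_iff) simp_all
  qed
  moreover note ring_frac_self[OF c]
  ultimately show ?thesis unfolding frac_deriv_def by blast
qed

lemma inj_ring_hom_nonzero:
  assumes "ring R" "ring T" "h \<in> ring_hom R T" "inj_on h (carrier R)"
    and "x \<in> carrier R - {\<zero>\<^bsub>R\<^esub>}"
  shows "h x \<in> carrier T - {\<zero>\<^bsub>T\<^esub>}"
  using assms(5) inj_onD[OF assms(4), of x "\<zero>\<^bsub>R\<^esub>"] ring_hom_zero[OF assms(3,1,2)]
    ring_hom_closed[OF assms(3)] ring.ring_simprules(2)[OF assms(1)] by auto

lemma frac_map_ring_frac:
  assumes "domain R" "domain T" and h: "h \<in> ring_hom R T" and inj: "inj_on h (carrier R)"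
    and c: "a \<in> carrier R" "b \<in> carrier R - {\<zero>\<^bsub>R\<^esub>}"
  shows "frac_map T h (ring_frac R a b) = ring_frac T (h a) (h b)"
proof -
  interpret R: domain R by fact
  interpret T: domain T by fact
  note h0 = inj_ring_hom_nonzero[OF R.ring_axioms T.ring_axioms h inj]
  have "ring_frac T (h x) (h y) = ring_frac T (h a) (h b)" if "(x, y) \<in> ring_frac R a b" for x y
  proof -
    from that have c': "x \<in> carrier R" "y \<in> carrier R - {\<zero>\<^bsub>R\<^esub>}"
      and e: "a \<otimes>\<^bsub>R\<^esub> y = x \<otimes>\<^bsub>R\<^esub> b"
      by (auto simp: ring_frac_def)
    have "h a \<otimes>\<^bsub>T\<^esub> h y = h x \<otimes>\<^bsub>T\<^esub> h b"
      using ring_hom_mult[OF h, of a y] ring_hom_mult[OF h, of x b] c c' e by simp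
    thus ?thesis
      using c c' h0 ring_hom_closed[OF h] by (subst T.ring_frac_eq_iff) auto
  qed
  with R.ring_frac_self[OF c] show ?thesis unfolding frac_map_def by blast
qed

text \<open>
  A fraction \<open>a/b\<close> is constant iff \<open>D a \<cdot> b = a \<cdot> D b\<close>.  So the hypothesis \<open>descent\<close> is precisely
  surjectivity onto the constants; injectivity is inherited from \<open>h\<close> by cross-multiplication.
\<close>

lemma frac_map_iso_constants:
  assumes "domain R" "domain T" and h: "h \<in> ring_hom R T" and inj: "inj_on h (carrier R)"
    and D: "\<And>a. a \<in> carrier T \<Longrightarrow> D a \<in> carrier T"
    and Leibniz: "\<And>a b. a \<in> carrier T \<Longrightarrow> b \<in> carrier T \<Longrightarrow>
      D (a \<otimes>\<^bsub>T\<^esub> b) = D a \<otimes>\<^bsub>T\<^esub> b \<oplus>\<^bsub>T\<^esub> a \<otimes>\<^bsub>T\<^esub> D b"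
    and const: "\<And>x. x \<in> carrier R \<Longrightarrow> D (h x) = \<zero>\<^bsub>T\<^esub>"
    and descent: "\<And>a b. a \<in> carrier T \<Longrightarrow> b \<in> carrier T - {\<zero>\<^bsub>T\<^esub>} \<Longrightarrow>
      D a \<otimes>\<^bsub>T\<^esub> b = a \<otimes>\<^bsub>T\<^esub> D b \<Longrightarrow>
      \<exists>x\<in>carrier R. \<exists>y\<in>carrier R - {\<zero>\<^bsub>R\<^esub>}. a \<otimes>\<^bsub>T\<^esub> h y = h x \<otimes>\<^bsub>T\<^esub> b"
  shows "frac_map T h \<in> ring_iso (frac_field R) (constants_ring (frac_field T) (frac_deriv T D))"
proof -
  interpret R: domain R by fact
  interpret T: domain T by fact
  note h_closed = ring_hom_closed[OF h] and h_mult = ring_hom_mult[OF h]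
    and h_add = ring_hom_add[OF h] and h_one = ring_hom_one[OF h]
  note h0 = inj_ring_hom_nonzero[OF R.ring_axioms T.ring_axioms h inj]
  note map = frac_map_ring_frac[OF assms(1-4)]
  have deriv: "frac_deriv T D (ring_frac T a b) =
      ring_frac T (D a \<otimes>\<^bsub>T\<^esub> b \<ominus>\<^bsub>T\<^esub> a \<otimes>\<^bsub>T\<^esub> D b) (b \<otimes>\<^bsub>T\<^esub> b)"
    if "a \<in> carrier T" "b \<in> carrier T - {\<zero>\<^bsub>T\<^esub>}" for a b
    by (rule T.frac_deriv_ring_frac[OF _ _ that]) (use D Leibniz in auto)
  have constant_iff: "frac_deriv T D (ring_frac T a b) = \<zero>\<^bsub>frac_field T\<^esub>
      \<longleftrightarrow> D a \<otimes>\<^bsub>T\<^esub> b = a \<otimes>\<^bsub>T\<^esub> D b"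
    if c: "a \<in> carrier T" "b \<in> carrier T - {\<zero>\<^bsub>T\<^esub>}" for a b
  proof -
    have z: "\<zero>\<^bsub>frac_field T\<^esub> = ring_frac T \<zero>\<^bsub>T\<^esub> \<one>\<^bsub>T\<^esub>" by (simp add: frac_field_def)
    have "frac_deriv T D (ring_frac T a b) = \<zero>\<^bsub>frac_field T\<^esub>
        \<longleftrightarrow> D a \<otimes>\<^bsub>T\<^esub> b \<ominus>\<^bsub>T\<^esub> a \<otimes>\<^bsub>T\<^esub> D b = \<zero>\<^bsub>T\<^esub>"
      unfolding deriv[OF c] z
      using c D[of a] D[of b] T.nonzero_mult_closed[OF c(2) c(2)]
      by (subst T.ring_frac_eq_iff) auto
    thus ?thesis using T.minus_eq_zero_iff[of "D a \<otimes>\<^bsub>T\<^esub> b" "a \<otimes>\<^bsub>T\<^esub> D b"] c D by simp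
  qed
  have closed: "frac_map T h X \<in> carrier (constants_ring (frac_field T) (frac_deriv T D))"
    if "X \<in> carrier (frac_field R)" for X
  proof -
    from that obtain a b where c: "a \<in> carrier R" "b \<in> carrier R - {\<zero>\<^bsub>R\<^esub>}"
      and X: "X = ring_frac R a b"
      by (rule R.frac_field_carrierE)
    have "frac_deriv T D (ring_frac T (h a) (h b)) = \<zero>\<^bsub>frac_field T\<^esub>"
      using c h_closed h0 const by (subst constant_iff) auto
    thus ?thesis
      using c h_closed h0 by (simp add: constants_ring_def X map T.ring_frac_closed)
  qed
  show ?thesis
    unfolding ring_iso_def
  proof (intro CollectI conjI ring_hom_memI)
    fix X assume "X \<in> carrier (frac_field R)"
    thus "frac_map T h X \<in> carrier (constants_ring (frac_field T) (frac_deriv T D))"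
      by (rule closed)
  next
    fix X Y assume "X \<in> carrier (frac_field R)" "Y \<in> carrier (frac_field R)"
    then obtain a b x y where c: "a \<in> carrier R" "b \<in> carrier R - {\<zero>\<^bsub>R\<^esub>}"
        "x \<in> carrier R" "y \<in> carrier R - {\<zero>\<^bsub>R\<^esub>}"
      and X: "X = ring_frac R a b" "Y = ring_frac R x y"
      by (metis R.frac_field_carrierE)
    note by_prod = R.nonzero_mult_closed[OF c(2,4)]
    note cT = h_closed[OF c(1)] h0[OF c(2)] h_closed[OF c(3)] h0[OF c(4)]
    show "frac_map T h (X \<otimes>\<^bsub>frac_field R\<^esub> Y) =
        frac_map T h X \<otimes>\<^bsub>constants_ring (frac_field T) (frac_deriv T D)\<^esub> frac_map T h Y"
      unfolding X R.frac_field_mult[OF c] map[OF c(1,2)] map[OF c(3,4)]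
        map[OF R.m_closed[OF c(1,3)] by_prod]
      using c T.frac_field_mult[OF cT] by (simp add: constants_ring_def h_mult)
    have "a \<otimes>\<^bsub>R\<^esub> y \<oplus>\<^bsub>R\<^esub> x \<otimes>\<^bsub>R\<^esub> b \<in> carrier R" using c by simp
    from map[OF this by_prod]
    show "frac_map T h (X \<oplus>\<^bsub>frac_field R\<^esub> Y) =
        frac_map T h X \<oplus>\<^bsub>constants_ring (frac_field T) (frac_deriv T D)\<^esub> frac_map T h Y"
      unfolding X R.frac_field_add[OF c] map[OF c(1,2)] map[OF c(3,4)]
      using c T.frac_field_add[OF cT] by (simp add: constants_ring_def h_mult h_add)
  next
    show "frac_map T h \<one>\<^bsub>frac_field R\<^esub> = \<one>\<^bsub>constants_ring (frac_field T) (frac_deriv T D)\<^esub>"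
      using map[of "\<one>\<^bsub>R\<^esub>" "\<one>\<^bsub>R\<^esub>"] by (simp add: constants_ring_def frac_field_def h_one)
  next
    show "bij_betw (frac_map T h) (carrier (frac_field R))
        (carrier (constants_ring (frac_field T) (frac_deriv T D)))"
      unfolding bij_betw_def
    proof
      show "inj_on (frac_map T h) (carrier (frac_field R))"
      proof (rule inj_onI)
        fix X Y assume "X \<in> carrier (frac_field R)" "Y \<in> carrier (frac_field R)"
          and eq: "frac_map T h X = frac_map T h Y"
        then obtain a b x y where c: "a \<in> carrier R" "b \<in> carrier R - {\<zero>\<^bsub>R\<^esub>}"
            "x \<in> carrier R" "y \<in> carrier R - {\<zero>\<^bsub>R\<^esub>}"
          and X: "X = ring_frac R a b" "Y = ring_frac R x y"
          by (metis R.frac_field_carrierE)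
        from eq have "h a \<otimes>\<^bsub>T\<^esub> h y = h x \<otimes>\<^bsub>T\<^esub> h b"
          unfolding X map[OF c(1,2)] map[OF c(3,4)]
          using T.ring_frac_eq_iff[OF h_closed[OF c(1)] h0[OF c(2)] h_closed[OF c(3)] h0[OF c(4)]]
          by simp
        hence "h (a \<otimes>\<^bsub>R\<^esub> y) = h (x \<otimes>\<^bsub>R\<^esub> b)" using c by (simp add: h_mult)
        with inj have "a \<otimes>\<^bsub>R\<^esub> y = x \<otimes>\<^bsub>R\<^esub> b" using c by (auto dest: inj_onD)
        thus "X = Y" unfolding X using c by (simp add: R.ring_frac_eq_iff)
      qed
      show "frac_map T h ` carrier (frac_field R)
          = carrier (constants_ring (frac_field T) (frac_deriv T D))"
      proof (intro equalityI subsetI)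
        fix Z assume "Z \<in> frac_map T h ` carrier (frac_field R)"
        thus "Z \<in> carrier (constants_ring (frac_field T) (frac_deriv T D))" using closed by blast
      next
        fix Z assume Z: "Z \<in> carrier (constants_ring (frac_field T) (frac_deriv T D))"
        hence "Z \<in> carrier (frac_field T)" by (simp add: constants_ring_def)
        then obtain a b where c: "a \<in> carrier T" "b \<in> carrier T - {\<zero>\<^bsub>T\<^esub>}" and Zab: "Z = ring_frac T a b"
          by (rule T.frac_field_carrierE)
        have "D a \<otimes>\<^bsub>T\<^esub> b = a \<otimes>\<^bsub>T\<^esub> D b"
          using Z constant_iff[OF c] by (simp add: constants_ring_def Zab)
        then obtain x y where xy: "x \<in> carrier R" "y \<in> carrier R - {\<zero>\<^bsub>R\<^esub>}"
          and e: "a \<otimes>\<^bsub>T\<^esub> h y = h x \<otimes>\<^bsub>T\<^esub> b"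
          using descent[OF c] by blast
        have "Z = frac_map T h (ring_frac R x y)"
          unfolding Zab map[OF xy] using T.ring_frac_eq_iff[OF c h_closed[OF xy(1)] h0[OF xy(2)]] e
          by simp
        thus "Z \<in> frac_map T h ` carrier (frac_field R)" using R.ring_frac_closed[OF xy] by blast
      qed
    qed
  qed
qed

section \<open>Derivations and subrings of polynomial rings\<close>

text \<open>
  The derivations on coefficients, on polynomials in \<open>\<lambda>\<close> and on polynomials in \<open>\<lambda>, \<mu>\<close> are treated
  uniformly, so the notion is needed over commutative rings and not only over fields.
\<close>

definition ring_derivation :: "('b::comm_ring_1 \<Rightarrow> 'b) \<Rightarrow> bool" where
  "ring_derivation D \<longleftrightarrow> (\<forall>x y. D (x + y) = D x + D y) \<and> (\<forall>x y. D (x * y) = D x * y + x * D y)"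

lemma ring_derivation_additive: "ring_derivation D \<Longrightarrow> additive D"
  by (simp add: ring_derivation_def additive_def)

lemmas ring_derivation_zero = additive.zero[OF ring_derivation_additive]
lemmas ring_derivation_diff = additive.diff[OF ring_derivation_additive]

lemma ring_derivation_add: "ring_derivation D \<Longrightarrow> D (x + y) = D x + D y"
  by (simp add: ring_derivation_def)

lemma ring_derivation_mult: "ring_derivation D \<Longrightarrow> D (x * y) = D x * y + x * D y"
  by (simp add: ring_derivation_def)

lemma ring_derivation_one: "ring_derivation D \<Longrightarrow> D 1 = 0"
  using ring_derivation_mult[of D 1 1] by simp

lemma ring_derivation_map_poly:
  assumes D: "ring_derivation D"
  shows "ring_derivation (map_poly D)"
proof -
  note [simp] = ring_derivation_zero[OF D] coeff_map_poly
  have "map_poly D (p * q) = map_poly D p * q + p * map_poly D q" for p q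
    by (rule poly_eqI)
      (simp add: coeff_mult additive.sum[OF ring_derivation_additive[OF D]]
        ring_derivation_mult[OF D] sum.distrib)
  moreover have "map_poly D (p + q) = map_poly D p + map_poly D q" for p q
    by (rule poly_eqI) (simp add: ring_derivation_add[OF D])
  ultimately show ?thesis by (simp add: ring_derivation_def)
qed

definition subring_set :: "'b::comm_ring_1 set \<Rightarrow> bool" where
  "subring_set S \<longleftrightarrow> 1 \<in> S \<and> (\<forall>x\<in>S. \<forall>y\<in>S. x - y \<in> S \<and> x * y \<in> S)"

lemma subring_setD:
  assumes "subring_set S"
  shows "1 \<in> S" "0 \<in> S" "x \<in> S \<Longrightarrow> - x \<in> S" "x \<in> S \<Longrightarrow> y \<in> S \<Longrightarrow> x - y \<in> S"
    "x \<in> S \<Longrightarrow> y \<in> S \<Longrightarrow> x * y \<in> S" "x \<in> S \<Longrightarrow> y \<in> S \<Longrightarrow> x + y \<in> S"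
proof -
  have d: "\<And>x y. x \<in> S \<Longrightarrow> y \<in> S \<Longrightarrow> x - y \<in> S" using assms by (simp add: subring_set_def)
  show "1 \<in> S" using assms by (simp add: subring_set_def)
  with d[of 1 1] show z: "0 \<in> S" by simp
  show m: "- x \<in> S" if "x \<in> S" for x using d[OF z that] by simp
  show "x + y \<in> S" if "x \<in> S" "y \<in> S" using d[OF that(1) m[OF that(2)]] by simp
qed (use assms in \<open>auto simp: subring_set_def\<close>)

lemma subring_set_sum: "subring_set S \<Longrightarrow> (\<And>i. i \<in> I \<Longrightarrow> g i \<in> S) \<Longrightarrow> sum g I \<in> S"
  by (induction I rule: infinite_finite_induct) (auto intro: subring_setD)

text \<open>
  Applied twice, this shows that \<open>S[\<lambda>, \<mu>]\<close> is a subring.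
\<close>

lemma subring_set_poly_over:
  assumes "subring_set S"
  shows "subring_set {p. poly_over S p}"
  using assms by (auto simp: subring_set_def[of "Collect _"] poly_over_def coeff_mult
      intro!: subring_set_sum intro: subring_setD)

definition bipoly_over :: "'b::field set \<Rightarrow> 'b poly poly set" where
  "bipoly_over S = {q. poly_over {p. poly_over S p} q}"

lemma carrier_bipoly_ring: "carrier (bipoly_ring S) = bipoly_over S"
  by (simp add: bipoly_ring_def bipoly_over_def poly_over_def)

lemma subring_set_bipoly_over: "subring_set S \<Longrightarrow> subring_set (bipoly_over S)"
  unfolding bipoly_over_def by (intro subring_set_poly_over)

lemma bipoly_over_UNIV: "q \<in> bipoly_over UNIV"
  by (simp add: bipoly_over_def poly_over_def)

lemma poly_over_pCons: "poly_over S (pCons a p) \<longleftrightarrow> a \<in> S \<and> poly_over S p"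
  by (auto simp: poly_over_def coeff_pCons split: nat.splits)

lemma poly_over_0: "subring_set S \<Longrightarrow> poly_over S 0"
  by (simp add: poly_over_def subring_setD)

lemma bipoly_over_0: "subring_set S \<Longrightarrow> 0 \<in> bipoly_over S"
  by (rule subring_setD(2)[OF subring_set_bipoly_over])

lemma bipoly_over_pCons: "pCons a q \<in> bipoly_over S \<longleftrightarrow> poly_over S a \<and> q \<in> bipoly_over S"
  by (simp add: bipoly_over_def poly_over_pCons)

lemma cring_bipoly_ring:
  assumes "subring_set (S :: 'b::field set)"
  shows "cring (bipoly_ring S)"
proof -
  note [simp] = subring_setD[OF subring_set_bipoly_over[OF assms]]
  have "\<exists>y\<in>bipoly_over S. y + x = 0" if "x \<in> bipoly_over S" for x
    using that by (intro bexI[of _ "- x"]) simp_all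
  thus ?thesis
    by (intro cringI abelian_groupI comm_monoidI)
      (auto simp: carrier_bipoly_ring, auto simp: bipoly_ring_def algebra_simps)
qed

section \<open>The spectral polynomial is prime\<close>

lemma degree_spectral_poly: "degree (spectral_poly R) = 2"
  by (simp add: spectral_poly_def)

text \<open>
  Division by the monic polynomial \<open>\<mu>\<^sup>2 + R\<close> stays inside \<open>S[\<lambda>, \<mu>]\<close>.  In the induction step, \<open>c + \<mu> q\<close>
  has the remainder \<open>c + a \<mu> + b \<mu>\<^sup>2\<close>, in which \<open>\<mu>\<^sup>2\<close> is replaced by \<open>- R\<close>.
\<close>

lemma spectral_reduction:
  assumes S: "subring_set (S :: 'b::field set)" and R: "poly_over S R" and q: "q \<in> bipoly_over S"
  obtains g a b where "g \<in> bipoly_over S" "poly_over S a" "poly_over S b"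
    "q = spectral_poly R * g + [:a, b:]"
proof -
  note T = subring_set_poly_over[OF S]
  have "\<exists>g a b. g \<in> bipoly_over S \<and> poly_over S a \<and> poly_over S b
      \<and> q = spectral_poly R * g + [:a, b:]"
    using q
  proof (induction q rule: pCons_induct)
    case 0
    show ?case using poly_over_0[OF S] bipoly_over_0[OF S]
      by (intro exI[of _ 0]) auto
  next
    case (pCons c q)
    then obtain g a b where IH: "g \<in> bipoly_over S" "poly_over S a" "poly_over S b"
      "q = spectral_poly R * g + [:a, b:]" and c: "poly_over S c"
      by (auto simp: bipoly_over_pCons)
    have "pCons c q = spectral_poly R * pCons b g + [:c - b * R, a:]"
      unfolding IH(4) by (simp add: spectral_poly_def algebra_simps)
    moreover have "pCons b g \<in> bipoly_over S" using IH by (simp add: bipoly_over_pCons)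
    moreover have "poly_over S (c - b * R)"
      using subring_setD(4)[OF T, of c] subring_setD(5)[OF T, of b R] IH(3) R c by simp
    ultimately show ?case using IH(2) by blast
  qed
  thus ?thesis using that by blast
qed

lemma spectral_dvd_reduced:
  fixes R :: "'b::field poly"
  assumes "spectral_poly R dvd [:a, b:]"
  shows "a = 0 \<and> b = 0"
proof (rule ccontr)
  assume "\<not> ?thesis"
  hence "[:a, b:] \<noteq> 0" by auto
  hence "degree (spectral_poly R) \<le> degree [:a, b:]" using assms by (rule dvd_imp_degree_le[rotated])
  thus False by (simp add: degree_spectral_poly split: if_splits)
qed

text \<open>
  The odd degree of \<open>R\<close> makes the norm form anisotropic: \<open>a\<^sup>2 = - R b\<^sup>2\<close> is impossible for degree
  parity unless both sides vanish.
\<close>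

lemma spectral_norm_eq_0:
  fixes R :: "'b::field poly"
  assumes "odd (degree R)" and eq: "a\<^sup>2 + R * b\<^sup>2 = 0"
  shows "a = 0 \<and> b = 0"
proof -
  have R: "R \<noteq> 0" using assms(1) by auto
  have *: "a\<^sup>2 = - (R * b\<^sup>2)" using eq by (simp add: eq_neg_iff_add_eq_0)
  show ?thesis
  proof (cases "b = 0")
    case False
    with * R have "a \<noteq> 0" by auto
    have "degree (a\<^sup>2) = degree (R * b\<^sup>2)" unfolding * by simp
    hence "2 * degree a = degree R + 2 * degree b"
      using False R \<open>a \<noteq> 0\<close> by (simp add: degree_mult_eq degree_power_eq)
    hence "even (degree R)" by presburger
    with assms(1) show ?thesis by simp
  qed (use * in auto)
qed

text \<open>
  Reduce both factors to \<open>a + b \<mu>\<close> and \<open>c + e \<mu>\<close>.  By the identity of Brahmagupta the product of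
  their norms is the norm of the reduced product, so one of the two norms vanishes.
\<close>

lemma spectral_dvd_mult:
  fixes R :: "'b::field poly"
  assumes odd: "odd (degree R)" and dvd: "spectral_poly R dvd p * q"
  shows "spectral_poly R dvd p \<or> spectral_poly R dvd q"
proof -
  have U: "subring_set (UNIV :: 'b set)" "\<And>p. poly_over UNIV (p :: 'b poly)"
    "\<And>q. q \<in> bipoly_over (UNIV :: 'b set)"
    by (auto simp: subring_set_def poly_over_def bipoly_over_UNIV)
  obtain g a b where p: "p = spectral_poly R * g + [:a, b:]"
    by (rule spectral_reduction[OF U(1) U(2) U(3)])
  obtain h c e where q: "q = spectral_poly R * h + [:c, e:]"
    by (rule spectral_reduction[OF U(1) U(2) U(3)])
  have r: "[:a, b:] * [:c, e:] = spectral_poly R * [:b * e:] + [:a * c - R * b * e, a * e + b * c:]"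
    by (simp add: spectral_poly_def algebra_simps)
  have "p * q = spectral_poly R * (g * q + [:a, b:] * h) + [:a, b:] * [:c, e:]"
    unfolding p q by (simp only: algebra_simps)
  also have "\<dots> = spectral_poly R * (g * q + [:a, b:] * h + [:b * e:])
      + [:a * c - R * b * e, a * e + b * c:]"
    unfolding r by (simp only: algebra_simps)
  finally have "p * q = \<dots>" .
  with dvd have "spectral_poly R dvd [:a * c - R * b * e, a * e + b * c:]"
    by (metis dvd_add_right_iff dvd_triv_left)
  hence z: "a * c - R * b * e = 0" "a * e + b * c = 0" by (auto dest: spectral_dvd_reduced)
  have "(a\<^sup>2 + R * b\<^sup>2) * (c\<^sup>2 + R * e\<^sup>2) = (a * c - R * b * e)\<^sup>2 + R * (a * e + b * c)\<^sup>2"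
    by (simp add: power2_eq_square algebra_simps)
  also have "\<dots> = 0" unfolding z by simp
  finally have "a\<^sup>2 + R * b\<^sup>2 = 0 \<or> c\<^sup>2 + R * e\<^sup>2 = 0" by simp
  hence "(a = 0 \<and> b = 0) \<or> (c = 0 \<and> e = 0)" using spectral_norm_eq_0[OF odd] by blast
  thus ?thesis unfolding p q by auto
qed

section \<open>Constant fractions on the spectral curve\<close>

locale spectral_curve =
  fixes d :: "'a::field_char_0 \<Rightarrow> 'a" and R :: "'a poly" and f :: "'a poly poly"
  assumes derivation: "derivation d"
    and R_const: "poly_over (constants d) R"
    and R_odd: "odd (degree R)"
    and f_def: "f = spectral_poly R"
begin

lemma d: "ring_derivation d"
  using derivation by (simp add: derivation_def ring_derivation_def)

lemmas d_poly = ring_derivation_map_poly[OF d]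

lemma d_bipoly: "ring_derivation (bipoly_deriv d)"
  unfolding bipoly_deriv_def by (rule ring_derivation_map_poly[OF d_poly])

lemma map_poly_d_eq_0_iff: "map_poly d p = 0 \<longleftrightarrow> poly_over (constants d) p"
  by (simp add: poly_eq_iff poly_over_def constants_def coeff_map_poly ring_derivation_zero[OF d])

lemma coeff_bipoly_deriv: "coeff (bipoly_deriv d q) i = map_poly d (coeff q i)"
  by (simp add: bipoly_deriv_def coeff_map_poly ring_derivation_zero[OF d_poly])

lemma bipoly_deriv_eq_0_iff: "bipoly_deriv d q = 0 \<longleftrightarrow> q \<in> bipoly_over (constants d)"
proof -
  have "bipoly_deriv d q = 0 \<longleftrightarrow> (\<forall>i. map_poly d (coeff q i) = 0)"
    unfolding poly_eq_iff[of "bipoly_deriv d q"] coeff_bipoly_deriv coeff_0 ..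
  thus ?thesis by (simp add: map_poly_d_eq_0_iff bipoly_over_def poly_over_def[of "Collect _"])
qed

lemma bipoly_deriv_pCons: "bipoly_deriv d (pCons a q) = pCons (map_poly d a) (bipoly_deriv d q)"
  by (rule poly_eqI) (simp add: coeff_bipoly_deriv coeff_pCons split: nat.splits)

lemma bipoly_deriv_0: "bipoly_deriv d 0 = 0"
  by (rule ring_derivation_zero[OF d_bipoly])

lemma bipoly_deriv_spectral: "bipoly_deriv d f = 0"
  using R_const
  by (simp add: f_def spectral_poly_def bipoly_deriv_pCons bipoly_deriv_0 map_poly_d_eq_0_iff[symmetric]
      ring_derivation_zero[OF d_poly] ring_derivation_one[OF d_poly])

lemma f_dvd_bipoly_deriv: "f dvd p \<Longrightarrow> f dvd bipoly_deriv d p"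
  by (auto simp: ring_derivation_mult[OF d_bipoly] bipoly_deriv_spectral elim!: dvdE)

lemma f_prime: "f dvd p * q \<Longrightarrow> f dvd p \<or> f dvd q"
  unfolding f_def by (rule spectral_dvd_mult[OF R_odd])

lemma f_dvd_reduced_iff: "f dvd [:a, b:] \<longleftrightarrow> a = 0 \<and> b = 0"
  unfolding f_def using spectral_dvd_reduced by auto

lemma reduction:
  assumes "subring_set S" "poly_over S R" "q \<in> bipoly_over S"
  obtains g a b where "g \<in> bipoly_over S" "poly_over S a" "poly_over S b" "q = f * g + [:a, b:]"
  unfolding f_def by (rule spectral_reduction[OF assms]) (use that f_def in auto)

lemma reduction_mod:
  obtains a b where "f dvd q - [:a, b:]"
proof -
  have U: "subring_set (UNIV :: 'a set)" "poly_over UNIV R" "q \<in> bipoly_over (UNIV :: 'a set)"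
    by (auto simp: subring_set_def poly_over_def bipoly_over_UNIV)
  obtain g a b where "q = f * g + [:a, b:]" by (rule reduction[OF U])
  hence "f dvd q - [:a, b:]" by simp
  thus ?thesis by (rule that)
qed

lemma degree_map_poly_d_less:
  assumes "lead_coeff y = 1" "map_poly d y \<noteq> 0"
  shows "degree (map_poly d y) < degree y"
proof -
  have "degree (map_poly d y) \<noteq> degree y"
  proof
    assume "degree (map_poly d y) = degree y"
    hence "lead_coeff (map_poly d y) = d (lead_coeff y)"
      by (simp add: coeff_map_poly ring_derivation_zero[OF d])
    with assms show False by (simp add: ring_derivation_one[OF d])
  qed
  moreover have "degree (map_poly d y) \<le> degree y"
    by (rule degree_le) (simp add: coeff_map_poly coeff_eq_0 ring_derivation_zero[OF d])
  ultimately show ?thesis by simp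
qed

text \<open>
  Every fraction \<open>p/q\<close> equals some \<open>x/y\<close> with \<open>y\<close> free of \<open>\<mu>\<close>: expand by the conjugate \<open>c - e \<mu>\<close> of
  \<open>q = c + e \<mu>\<close>, so that \<open>y\<close> is the norm of \<open>q\<close>.
\<close>

lemma exists_multiple_mod:
  assumes q: "\<not> f dvd q"
  obtains y x where "y \<noteq> 0" "f dvd p * [:y:] - x * q"
proof -
  obtain c e where ce: "f dvd q - [:c, e:]" by (rule reduction_mod)
  with q have "\<not> (c = 0 \<and> e = 0)" by auto
  hence N: "c\<^sup>2 + R * e\<^sup>2 \<noteq> 0" using spectral_norm_eq_0[OF R_odd] by blast
  have norm: "[:c\<^sup>2 + R * e\<^sup>2:] = f * [:e\<^sup>2:] + [:c, - e:] * [:c, e:]"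
    by (simp add: f_def spectral_poly_def power2_eq_square algebra_simps)
  have "p * [:c\<^sup>2 + R * e\<^sup>2:] - (p * [:c, - e:]) * q
      = f * (p * [:e\<^sup>2:]) - (q - [:c, e:]) * (p * [:c, - e:])"
    unfolding norm by (simp only: algebra_simps)
  hence "f dvd p * [:c\<^sup>2 + R * e\<^sup>2:] - (p * [:c, - e:]) * q"
    using ce by (metis dvd_diff dvd_mult2 dvd_triv_left)
  with N that show ?thesis by blast
qed

text \<open>
  This is the heart of the second claim: a denominator \<open>y \<in> \<Sigma>[\<lambda>]\<close> that is monic and of least degree
  has constant coefficients.  The argument takes place over the whole field \<open>\<Sigma>\<close>; the coefficients of \<open>x\<close> and
  \<open>y\<close> end up in the field of constants anyway.
\<close>

lemma constant_fraction:
  assumes q: "\<not> f dvd q" and const: "f dvd bipoly_deriv d p * q - p * bipoly_deriv d q"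
  obtains y x where "poly_over (constants d) y" "y \<noteq> 0" "x \<in> bipoly_over (constants d)"
    "f dvd p * [:y:] - x * q"
proof -
  let ?D = "bipoly_deriv d"
  define P where "P y \<longleftrightarrow> y \<noteq> 0 \<and> (\<exists>x. f dvd p * [:y:] - x * q)" for y
  have "\<exists>y. P y" using exists_multiple_mod[OF q] unfolding P_def by metis
  then obtain y0 where y0: "P y0" and min: "\<And>z. P z \<Longrightarrow> degree y0 \<le> degree z"
    using ex_has_least_nat[of P _ degree] by blast
  define y where "y = smult (inverse (lead_coeff y0)) y0"
  have y0_nz: "y0 \<noteq> 0" using y0 by (simp add: P_def)
  hence y: "y \<noteq> 0" "lead_coeff y = 1" "degree y = degree y0" by (simp_all add: y_def)
  obtain x0 where x0: "f dvd p * [:y0:] - x0 * q" using y0 by (auto simp: P_def)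
  \<comment> \<open>A reduced numerator is determined by its class, so that \<open>x'\<close> vanishes as soon as \<open>f\<close> divides it.\<close>
  let ?k = "[:[:inverse (lead_coeff y0):]:]"
  obtain a b where ab: "f dvd ?k * x0 - [:a, b:]" by (rule reduction_mod)
  define x where "x = [:a, b:]"
  have "[:y:] = ?k * [:y0:]" by (simp add: y_def)
  hence "p * [:y:] - x * q = ?k * (p * [:y0:] - x0 * q) + (?k * x0 - x) * q"
    by (simp only: algebra_simps)
  hence dvd: "f dvd p * [:y:] - x * q" using x0 ab by (metis dvd_add dvd_mult dvd_mult2 x_def)
  have D_y: "?D [:y:] = [:map_poly d y:]" by (simp add: bipoly_deriv_pCons bipoly_deriv_0)
  have "f dvd ?D (p * [:y:] - x * q)" by (rule f_dvd_bipoly_deriv[OF dvd])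
  hence dvd': "f dvd ?D p * [:y:] + p * ?D [:y:] - (?D x * q + x * ?D q)"
    by (simp only: ring_derivation_diff[OF d_bipoly] ring_derivation_mult[OF d_bipoly])
  \<comment> \<open>Modulo \<open>f\<close>, the terms \<open>p' y q\<close> and \<open>x q q'\<close> both equal \<open>p q' y\<close> and cancel.\<close>
  have "(p * ?D [:y:] - ?D x * q) * q
      = (?D p * [:y:] + p * ?D [:y:] - (?D x * q + x * ?D q)) * q
        - (?D p * q - p * ?D q) * [:y:] - (p * [:y:] - x * q) * ?D q"
    by (simp add: algebra_simps)
  hence "f dvd (p * ?D [:y:] - ?D x * q) * q"
    using dvd dvd' const by (metis dvd_diff dvd_mult2)
  hence drop: "f dvd p * [:map_poly d y:] - ?D x * q" using f_prime q D_y by auto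
  have Dy: "map_poly d y = 0"
  proof (rule ccontr)
    assume nz: "map_poly d y \<noteq> 0"
    hence "P (map_poly d y)" using drop by (auto simp: P_def)
    from min[OF this] degree_map_poly_d_less[OF y(2) nz] y(3) show False by simp
  qed
  with drop have "f dvd ?D x * q" by simp
  hence "f dvd ?D x" using f_prime q by blast
  hence "?D x = 0"
    by (simp add: x_def bipoly_deriv_pCons bipoly_deriv_0 f_dvd_reduced_iff)
  thus ?thesis using that[of y x] y dvd Dy
    by (simp add: map_poly_d_eq_0_iff bipoly_deriv_eq_0_iff)
qed

end

section \<open>Coordinate rings as differential domains\<close>

text \<open>
  The ground field \<open>S\<close> of the coordinate ring is a parameter, since the results of this part are used
  both for \<open>S = K\<close> and for \<open>S = C\<close>.
\<close>

locale spectral_curve_over = spectral_curve d R f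
  for d :: "'a::field_char_0 \<Rightarrow> 'a" and R :: "'a poly" and f :: "'a poly poly" +
  fixes S :: "'a set"
  assumes S_diff: "diff_subfield d S" and constants_S: "constants d \<subseteq> S"
begin

abbreviation "Q \<equiv> coord_ring S f"
abbreviation "cls \<equiv> curve_coset S f"

lemma S: "subring_set S"
proof -
  have "x - y \<in> S" if "x \<in> S" "y \<in> S" for x y
    using that S_diff unfolding diff_subfield_def by (metis diff_conv_add_uminus)
  thus ?thesis using S_diff by (auto simp: subring_set_def diff_subfield_def)
qed

lemmas Bi = subring_setD[OF subring_set_bipoly_over[OF S]]

lemma R_S: "poly_over S R"
  using R_const constants_S by (auto simp: poly_over_def)

lemma f_S: "f \<in> bipoly_over S"
  using R_S subring_setD(1)[OF subring_set_poly_over[OF S]] poly_over_0[OF S] bipoly_over_0[OF S]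
  by (simp add: f_def spectral_poly_def bipoly_over_pCons)

lemma deriv_S: "q \<in> bipoly_over S \<Longrightarrow> bipoly_deriv d q \<in> bipoly_over S"
  using S_diff
  by (simp add: bipoly_over_def poly_over_def coeff_bipoly_deriv coeff_map_poly
      ring_derivation_zero[OF d] diff_subfield_def)

lemma quotient_S:
  assumes q: "q \<in> bipoly_over S" and dvd: "f dvd q"
  obtains g where "g \<in> bipoly_over S" "q = g * f"
proof (rule reduction[OF S R_S q])
  fix g a b assume g: "g \<in> bipoly_over S" and e: "q = f * g + [:a, b:]"
  from dvd have "f dvd [:a, b:]" unfolding e by (simp add: dvd_add_right_iff)
  hence "q = g * f" using e by (simp add: f_dvd_reduced_iff)
  with g that show ?thesis by blast
qed

lemma curve_ideal_eq: "curve_ideal S f = {g \<in> bipoly_over S. f dvd g}"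
proof -
  have "curve_ideal S f = {g * f |g. g \<in> bipoly_over S}"
    unfolding curve_ideal_def cgenideal_def carrier_bipoly_ring by (simp add: bipoly_ring_def)
  moreover have "g * f \<in> bipoly_over S" if "g \<in> bipoly_over S" for g
    using that f_S by (rule Bi(5))
  moreover have "\<exists>h. g = h * f \<and> h \<in> bipoly_over S" if "g \<in> bipoly_over S" "f dvd g" for g
    using that by (metis quotient_S)
  ultimately show ?thesis by auto
qed

text \<open>
  The cofactor of \<open>f\<close> automatically has coefficients in \<open>S\<close>, so membership in a coset is divisibility
  by \<open>f\<close> in the polynomial ring over the whole field.  Cosets over different ground fields thus become
  comparable.
\<close>

lemma cls_eq:
  assumes "q \<in> bipoly_over S"
  shows "cls q = {g \<in> bipoly_over S. f dvd g - q}"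
proof -
  have "cls q = {g + q |g. g \<in> bipoly_over S \<and> f dvd g}"
    unfolding curve_coset_def a_r_coset_def' curve_ideal_eq by (auto simp: bipoly_ring_def)
  also have "\<dots> = {g \<in> bipoly_over S. f dvd g - q}"
    using Bi(4)[OF _ assms] Bi(6)[OF _ assms] by (auto intro!: exI[of _ "_ - q"])
  finally show ?thesis .
qed

lemma cls_self: "q \<in> bipoly_over S \<Longrightarrow> q \<in> cls q"
  by (simp add: cls_eq)

lemma cls_eq_iff:
  assumes "p \<in> bipoly_over S" "q \<in> bipoly_over S"
  shows "cls p = cls q \<longleftrightarrow> f dvd p - q"
proof
  assume "cls p = cls q"
  with cls_self[OF assms(1)] have "p \<in> cls q" by simp
  thus "f dvd p - q" by (simp add: cls_eq assms)
next
  assume "f dvd p - q"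
  hence "f dvd g - p \<longleftrightarrow> f dvd g - q" for g
    using dvd_add_left_iff[of f "p - q" "g - p"] by simp
  thus "cls p = cls q" by (simp add: cls_eq assms)
qed

lemma curve_ideal: "ideal (curve_ideal S f) (bipoly_ring S)"
  unfolding curve_ideal_def
  using cring.cgenideal_ideal[OF cring_bipoly_ring[OF S]] f_S by (simp add: carrier_bipoly_ring)

lemma carrier_Q: "carrier Q = cls ` bipoly_over S"
  unfolding coord_ring_def curve_coset_def FactRing_simps by (auto simp: carrier_bipoly_ring)

lemma cls_hom: "cls \<in> ring_hom (bipoly_ring S) Q"
  unfolding coord_ring_def curve_coset_def[abs_def] by (rule ideal.rcos_ring_hom[OF curve_ideal])

lemma cls_mult:
  "p \<in> bipoly_over S \<Longrightarrow> q \<in> bipoly_over S \<Longrightarrow> cls p \<otimes>\<^bsub>Q\<^esub> cls q = cls (p * q)"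
  using ring_hom_mult[OF cls_hom, of p q] unfolding carrier_bipoly_ring by (simp add: bipoly_ring_def)

lemma cls_add:
  "p \<in> bipoly_over S \<Longrightarrow> q \<in> bipoly_over S \<Longrightarrow> cls p \<oplus>\<^bsub>Q\<^esub> cls q = cls (p + q)"
  using ring_hom_add[OF cls_hom, of p q] unfolding carrier_bipoly_ring by (simp add: bipoly_ring_def)

lemma one_Q: "\<one>\<^bsub>Q\<^esub> = cls 1"
  using ring_hom_one[OF cls_hom] by (simp add: bipoly_ring_def)

lemma zero_Q: "\<zero>\<^bsub>Q\<^esub> = cls 0"
  using cls_eq[OF Bi(2)] curve_ideal_eq by (simp add: coord_ring_def FactRing_def)

lemma cls_eq_zero_iff: "q \<in> bipoly_over S \<Longrightarrow> cls q = \<zero>\<^bsub>Q\<^esub> \<longleftrightarrow> f dvd q"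
  unfolding zero_Q using cls_eq_iff[OF _ Bi(2)] by simp

lemma domain_Q: "domain Q"
proof (intro domain.intro domain_axioms.intro)
  show "cring Q" unfolding coord_ring_def
    by (rule ideal.quotient_is_cring[OF curve_ideal cring_bipoly_ring[OF S]])
  show "\<one>\<^bsub>Q\<^esub> \<noteq> \<zero>\<^bsub>Q\<^esub>"
    unfolding one_Q cls_eq_zero_iff[OF Bi(1)] using f_dvd_reduced_iff[of 1 0] by (simp add: one_pCons)
  show "a = \<zero>\<^bsub>Q\<^esub> \<or> b = \<zero>\<^bsub>Q\<^esub>"
    if "a \<otimes>\<^bsub>Q\<^esub> b = \<zero>\<^bsub>Q\<^esub>" "a \<in> carrier Q" "b \<in> carrier Q" for a b
  proof -
    from that(2,3) obtain p q where pq: "p \<in> bipoly_over S" "q \<in> bipoly_over S"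
      and ab: "a = cls p" "b = cls q" unfolding carrier_Q by blast
    from that(1) have "f dvd p * q"
      unfolding ab cls_mult[OF pq] cls_eq_zero_iff[OF Bi(5)[OF pq]] .
    thus ?thesis unfolding ab cls_eq_zero_iff[OF pq(1)] cls_eq_zero_iff[OF pq(2)] by (rule f_prime)
  qed
qed

lemma coord_deriv_cls:
  assumes "q \<in> bipoly_over S"
  shows "coord_deriv d S f (cls q) = cls (bipoly_deriv d q)"
proof -
  have "cls (bipoly_deriv d g) = cls (bipoly_deriv d q)" if "g \<in> cls q" for g
  proof -
    from that have g: "g \<in> bipoly_over S" "f dvd g - q" by (auto simp: cls_eq assms)
    from f_dvd_bipoly_deriv[OF g(2)] show ?thesis
      using cls_eq_iff[OF deriv_S[OF g(1)] deriv_S[OF assms]]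
      by (simp add: ring_derivation_diff[OF d_bipoly])
  qed
  thus ?thesis unfolding coord_deriv_def using cls_self[OF assms] by blast
qed

end

section \<open>The constants of the coordinate ring and of its fraction field\<close>

lemma diff_subfield_constants:
  assumes "derivation d"
  shows "diff_subfield d (constants d)"
proof -
  have D: "ring_derivation d" using assms by (simp add: derivation_def ring_derivation_def)
  have "d (inverse x) = 0" if "d x = 0" for x
  proof (cases "x = 0")
    case False
    have "d x * inverse x + x * d (inverse x) = d 1"
      using False by (simp add: ring_derivation_mult[OF D, symmetric])
    thus ?thesis using that False by (simp add: ring_derivation_one[OF D])
  qed (use that in simp)
  thus ?thesis
    by (simp add: diff_subfield_def constants_def ring_derivation_zero[OF D] ring_derivation_one[OF D]
        ring_derivation_add[OF D] ring_derivation_mult[OF D]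
        additive.minus[OF ring_derivation_additive[OF D]])
qed

lemma diff_subfield_adjoin:
  "diff_subfield d (diff_field_adjoin d u)" "constants d \<subseteq> diff_field_adjoin d u"
  by (auto simp: diff_subfield_def diff_field_adjoin_def)

context spectral_curve_over
begin

interpretation C: spectral_curve_over d R f "constants d"
  by unfold_locales (use diff_subfield_constants[OF derivation] in auto)

lemma C_S: "q \<in> bipoly_over (constants d) \<Longrightarrow> q \<in> bipoly_over S"
  using constants_S by (auto simp: bipoly_over_def poly_over_def)

lemma coord_embed_cls:
  assumes "q \<in> bipoly_over (constants d)"
  shows "coord_embed S f (curve_coset (constants d) f q) = cls q"
proof -
  have "cls g = cls q" if "g \<in> curve_coset (constants d) f q" for g
    using that cls_eq_iff[OF C_S C_S[OF assms], of g] by (simp add: C.cls_eq[OF assms])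
  thus ?thesis unfolding coord_embed_def using C.cls_self[OF assms] by blast
qed

lemma coord_embed_hom: "coord_embed S f \<in> ring_hom (coord_ring (constants d) f) Q"
proof (rule ring_hom_memI)
  fix x y assume "x \<in> carrier (coord_ring (constants d) f)" "y \<in> carrier (coord_ring (constants d) f)"
  then obtain p q where pq: "p \<in> bipoly_over (constants d)" "q \<in> bipoly_over (constants d)"
    and xy: "x = curve_coset (constants d) f p" "y = curve_coset (constants d) f q"
    unfolding C.carrier_Q by blast
  show "coord_embed S f (x \<otimes>\<^bsub>coord_ring (constants d) f\<^esub> y)
      = coord_embed S f x \<otimes>\<^bsub>Q\<^esub> coord_embed S f y"
    unfolding xy C.cls_mult[OF pq] coord_embed_cls[OF pq(1)] coord_embed_cls[OF pq(2)]
      coord_embed_cls[OF C.Bi(5)[OF pq]] cls_mult[OF C_S[OF pq(1)] C_S[OF pq(2)]] ..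
  show "coord_embed S f (x \<oplus>\<^bsub>coord_ring (constants d) f\<^esub> y)
      = coord_embed S f x \<oplus>\<^bsub>Q\<^esub> coord_embed S f y"
    unfolding xy C.cls_add[OF pq] coord_embed_cls[OF pq(1)] coord_embed_cls[OF pq(2)]
      coord_embed_cls[OF C.Bi(6)[OF pq]] cls_add[OF C_S[OF pq(1)] C_S[OF pq(2)]] ..
next
  fix x assume "x \<in> carrier (coord_ring (constants d) f)"
  then obtain p where p: "p \<in> bipoly_over (constants d)" "x = curve_coset (constants d) f p"
    unfolding C.carrier_Q by blast
  show "coord_embed S f x \<in> carrier Q"
    unfolding p(2) coord_embed_cls[OF p(1)] carrier_Q using C_S[OF p(1)] by blast
next
  show "coord_embed S f \<one>\<^bsub>coord_ring (constants d) f\<^esub> = \<one>\<^bsub>Q\<^esub>"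
    unfolding C.one_Q one_Q by (rule coord_embed_cls[OF C.Bi(1)])
qed

lemma coord_embed_inj: "inj_on (coord_embed S f) (carrier (coord_ring (constants d) f))"
proof (rule inj_onI)
  fix x y assume "x \<in> carrier (coord_ring (constants d) f)" "y \<in> carrier (coord_ring (constants d) f)"
    and eq: "coord_embed S f x = coord_embed S f y"
  then obtain p q where pq: "p \<in> bipoly_over (constants d)" "q \<in> bipoly_over (constants d)"
    and xy: "x = curve_coset (constants d) f p" "y = curve_coset (constants d) f q"
    unfolding C.carrier_Q by blast
  from eq show "x = y"
    unfolding xy coord_embed_cls[OF pq(1)] coord_embed_cls[OF pq(2)]
      cls_eq_iff[OF C_S[OF pq(1)] C_S[OF pq(2)]] C.cls_eq_iff[OF pq] .
qed

lemma coord_deriv_embed: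
  assumes "x \<in> carrier (coord_ring (constants d) f)"
  shows "coord_deriv d S f (coord_embed S f x) = \<zero>\<^bsub>Q\<^esub>"
proof -
  from assms obtain p where p: "p \<in> bipoly_over (constants d)" "x = curve_coset (constants d) f p"
    unfolding C.carrier_Q by blast
  have "bipoly_deriv d p = 0" using p(1) by (simp only: bipoly_deriv_eq_0_iff)
  thus ?thesis
    by (simp only: p(2) coord_embed_cls[OF p(1)] coord_deriv_cls[OF C_S[OF p(1)]] zero_Q)
qed

text \<open>
  The derivative of a reduced representative \<open>a + b \<mu>\<close> is again reduced, so it is zero modulo \<open>f\<close> only
  if \<open>a\<close> and \<open>b\<close> have constant coefficients.
\<close>

lemma coord_ring_constants:
  "coord_embed S f \<in> ring_iso (coord_ring (constants d) f) (constants_ring Q (coord_deriv d S f))"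
proof -
  have onto: "x \<in> coord_embed S f ` carrier (coord_ring (constants d) f)"
    if x: "x \<in> carrier Q" "coord_deriv d S f x = \<zero>\<^bsub>Q\<^esub>" for x
  proof -
    from x(1) obtain q where q: "q \<in> bipoly_over S" "x = cls q" unfolding carrier_Q by blast
    obtain g a b where g: "g \<in> bipoly_over S" and ab: "poly_over S a" "poly_over S b"
      and e: "q = f * g + [:a, b:]" by (rule reduction[OF S R_S q(1)])
    have r: "[:a, b:] \<in> bipoly_over S"
      using ab bipoly_over_0[OF S] by (simp add: bipoly_over_pCons)
    have x_eq: "x = cls [:a, b:]"
      unfolding q(2) cls_eq_iff[OF q(1) r] by (simp add: e)
    have "f dvd bipoly_deriv d [:a, b:]"
      using x(2) unfolding x_eq coord_deriv_cls[OF r] cls_eq_zero_iff[OF deriv_S[OF r]] .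
    hence "bipoly_deriv d [:a, b:] = 0"
      by (simp add: bipoly_deriv_pCons bipoly_deriv_0 f_dvd_reduced_iff)
    hence c: "[:a, b:] \<in> bipoly_over (constants d)" by (simp only: bipoly_deriv_eq_0_iff)
    show ?thesis
      unfolding x_eq coord_embed_cls[OF c, symmetric] C.carrier_Q using c by blast
  qed
  have "coord_embed S f \<in> ring_hom (coord_ring (constants d) f) (constants_ring Q (coord_deriv d S f))"
    using coord_embed_hom coord_deriv_embed by (auto simp: ring_hom_def constants_ring_def)
  moreover have "bij_betw (coord_embed S f) (carrier (coord_ring (constants d) f))
      (carrier (constants_ring Q (coord_deriv d S f)))"
    unfolding bij_betw_def using coord_embed_inj coord_deriv_embed onto
      ring_hom_closed[OF coord_embed_hom] by (auto simp: constants_ring_def)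
  ultimately show ?thesis by (simp add: ring_iso_def)
qed

lemma frac_field_constants:
  "frac_map Q (coord_embed S f) \<in> ring_iso (frac_field (coord_ring (constants d) f))
     (constants_ring (frac_field Q) (frac_deriv Q (coord_deriv d S f)))"
proof (rule frac_map_iso_constants[OF C.domain_Q domain_Q coord_embed_hom coord_embed_inj])
  fix a b assume ab: "a \<in> carrier Q" "b \<in> carrier Q"
  then obtain p q where pq: "p \<in> bipoly_over S" "q \<in> bipoly_over S"
    and e: "a = cls p" "b = cls q" unfolding carrier_Q by blast
  note D = deriv_S[OF pq(1)] deriv_S[OF pq(2)]
  show "coord_deriv d S f (a \<otimes>\<^bsub>Q\<^esub> b) =
      coord_deriv d S f a \<otimes>\<^bsub>Q\<^esub> b \<oplus>\<^bsub>Q\<^esub> a \<otimes>\<^bsub>Q\<^esub> coord_deriv d S f b"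
    unfolding e cls_mult[OF pq] coord_deriv_cls[OF Bi(5)[OF pq]] coord_deriv_cls[OF pq(1)]
      coord_deriv_cls[OF pq(2)] cls_mult[OF D(1) pq(2)] cls_mult[OF pq(1) D(2)]
      cls_add[OF Bi(5)[OF D(1) pq(2)] Bi(5)[OF pq(1) D(2)]] ring_derivation_mult[OF d_bipoly] ..
next
  fix a assume "a \<in> carrier Q"
  thus "coord_deriv d S f a \<in> carrier Q"
    unfolding carrier_Q using coord_deriv_cls deriv_S by auto
next
  fix x assume "x \<in> carrier (coord_ring (constants d) f)"
  thus "coord_deriv d S f (coord_embed S f x) = \<zero>\<^bsub>Q\<^esub>" by (rule coord_deriv_embed)
next
  fix a b assume a: "a \<in> carrier Q" and b: "b \<in> carrier Q - {\<zero>\<^bsub>Q\<^esub>}"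
    and const: "coord_deriv d S f a \<otimes>\<^bsub>Q\<^esub> b = a \<otimes>\<^bsub>Q\<^esub> coord_deriv d S f b"
  from a b obtain p q where pq: "p \<in> bipoly_over S" "q \<in> bipoly_over S"
    and e: "a = cls p" "b = cls q" unfolding carrier_Q by blast
  note D = deriv_S[OF pq(1)] deriv_S[OF pq(2)]
  have q: "\<not> f dvd q" using b by (simp only: e cls_eq_zero_iff[OF pq(2)] Diff_iff singleton_iff) simp
  have "f dvd bipoly_deriv d p * q - p * bipoly_deriv d q"
    using const unfolding e coord_deriv_cls[OF pq(1)] coord_deriv_cls[OF pq(2)]
      cls_mult[OF D(1) pq(2)] cls_mult[OF pq(1) D(2)]
      cls_eq_iff[OF Bi(5)[OF D(1) pq(2)] Bi(5)[OF pq(1) D(2)]] .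
  then obtain y x where y: "poly_over (constants d) y" "y \<noteq> 0" and x: "x \<in> bipoly_over (constants d)"
    and dvd: "f dvd p * [:y:] - x * q"
    by (rule constant_fraction[OF q])
  have yC: "[:y:] \<in> bipoly_over (constants d)"
    using y bipoly_over_0[OF C.S] by (simp add: bipoly_over_pCons)
  have "a \<otimes>\<^bsub>Q\<^esub> coord_embed S f (C.cls [:y:]) = coord_embed S f (C.cls x) \<otimes>\<^bsub>Q\<^esub> b"
    unfolding e coord_embed_cls[OF yC] coord_embed_cls[OF x] cls_mult[OF pq(1) C_S[OF yC]]
      cls_mult[OF C_S[OF x] pq(2)] cls_eq_iff[OF Bi(5)[OF pq(1) C_S[OF yC]] Bi(5)[OF C_S[OF x] pq(2)]]
    by (rule dvd)
  moreover have "C.cls [:y:] \<in> carrier C.Q - {\<zero>\<^bsub>C.Q\<^esub>}"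
    using C.cls_eq_zero_iff[OF yC] f_dvd_reduced_iff[of y 0] y(2) yC unfolding C.carrier_Q by auto
  moreover have "C.cls x \<in> carrier C.Q" unfolding C.carrier_Q using x by blast
  ultimately show "\<exists>x\<in>carrier (coord_ring (constants d) f).
      \<exists>y\<in>carrier (coord_ring (constants d) f) - {\<zero>\<^bsub>coord_ring (constants d) f\<^esub>}.
        a \<otimes>\<^bsub>Q\<^esub> coord_embed S f y = coord_embed S f x \<otimes>\<^bsub>Q\<^esub> b"
    by blast
qed

end

theorem theorem3p5:
  fixes d :: "'a::field_char_0 \<Rightarrow> 'a" and C K :: "'a set" and u :: 'a and s :: nat
    and A R :: "'a poly" and f :: "'a poly poly"
  assumes "derivation d"
    and "C = constants d"
    and "alg_closed_in C"
    and "u \<notin> C"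
    and "algebro_geometric d (schroedinger u)"
    and "is_partner d (schroedinger u) s A R"
    and "K = diff_field_adjoin d u"
    and "f = spectral_poly R"
  shows "coord_embed K f \<in> ring_iso (coord_ring C f)
           (constants_ring (coord_ring K f) (coord_deriv d K f))
       \<and> frac_map (coord_ring K f) (coord_embed K f) \<in> ring_iso (frac_field (coord_ring C f))
           (constants_ring (frac_field (coord_ring K f))
              (frac_deriv (coord_ring K f) (coord_deriv d K f)))"
proof -
  interpret spectral_curve_over d R f K
    using assms(1,6,8) diff_subfield_adjoin[of d u]
    by unfold_locales (auto simp: is_partner_def assms(7))
  show ?thesis using coord_ring_constants frac_field_constants by (simp add: assms(2))
qed

end
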